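(* Let $\mathcal{M}\subset\mathbb{R}^4$, $M_4\subset\mathbb{R}^4$, the orthogonal projection $\pi:\mathbb{R}^4\to H_E$, and $U_3=\pi(M_4)$ be as defined in the context. Then the bodies $U_3$ and $\pi(\mathcal{M})$ coincide, i.e. $\pi(M_4)=\pi(\mathcal{M})$.
   Context: Let $A,B,C,D,E\in\mathbb{R}^4$ be the vertices of a regular $4$-simplex with side length $1$, placed so that the vectors $A,B,C,D$ form an orthogonal basis of $\mathbb{R}^4$, each of norm $1/\sqrt{2}$, and $E=\frac{\varphi}{2}(A+B+C+D)$, where $\varphi=\frac{1+\sqrt5}{2}$. $\mathcal{B}(x,r)$ is the closed ball and $\mathcal{S}(x,r)$ the sphere (boundary of $\mathcal{B}(x,r)$) of radius $r$ centered at $x$ in $\mathbb{R}^4$; $\operatorname{pos}(T)$ is the positive cone (set of all linear combinations with non-negative coefficients) of $T$; $M_{Z,W}$ is the midpoint of $Z$ and $W$. For distinct $X,Y\in\{A,B,C,D\}$, with $\{Z,W\}=\{A,B,C,D\}\setminus\{X,Y\}$, let $$\mathcal{F}_{X,Y}=\operatorname{pos}(\{X,Y,E\})\cap\mathcal{S}(M_{Z,W},\sqrt{3}/2).$$ Define $$\mathcal{M}_0=\bigcup_{X\ne Y\in\{A,B,C,D\}}\mathcal{F}_{X,Y},\qquad \mathcal{M}=\bigcap_{P\in\mathcal{M}_0}\mathcal{B}(P,1).$$ Let $H_E$ be the $3$-dimensional linear subspace of $\mathbb{R}^4$ orthogonal to $E$, and $\pi:\mathbb{R}^4\to H_E$ the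 orthogonal projection. Let $\mathbb{R}^4_+$ denote the closed non-negative orthant with respect to the orthonormal basis $\sqrt2A,\sqrt2B,\sqrt2C,\sqrt2D$, i.e. $\mathbb{R}^4_+=\operatorname{pos}(\{A,B,C,D\})$. Define $$M_4=\left\{v-w : v,w\in\mathbb{R}^4_+,\ \|v\|^2+\left(\|w\|+\tfrac{1}{\sqrt2}\right)^2\le 1\right\},\qquad U_3=\pi(M_4).$$ *)

theory Defs
  imports "HOL-Analysis.Analysis"
begin

definition golden_ratio :: real where
  "golden_ratio = (1 + sqrt 5) / 2"

(* The linear combinations are finite, so T itself need not be. *)
definition pos :: "'a::real_vector set \<Rightarrow> 'a set" where
  "pos T = {\<Sum>x\<in>F. c x *\<^sub>R x | F c. finite F \<and> F \<subseteq> T \<and> (\<forall>x\<in>F. 0 \<le> c x)}"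

definition orthogonal_projection :: "'a::euclidean_space set \<Rightarrow> 'a \<Rightarrow> 'a" where
  "orthogonal_projection H x = (THE p. p \<in> H \<and> (\<forall>y\<in>H. orthogonal (x - p) y))"

definition orthogonal_hyperplane :: "'a::euclidean_space \<Rightarrow> 'a set" where
  "orthogonal_hyperplane E = {x. orthogonal E x}"

text \<open>Below, \<open>V\<close> stands for \<open>{A, B, C, D}\<close>, and \<open>E\<close> for the remaining vertex of the simplex.\<close>

definition face_piece :: "'a::euclidean_space \<Rightarrow> 'a \<Rightarrow> 'a \<Rightarrow> 'a \<Rightarrow> 'a \<Rightarrow> 'a set" where
  "face_piece E X Y Z W = pos {X, Y, E} \<inter> sphere (midpoint Z W) (sqrt 3 / 2)"

(* Since V has four elements, {Z, W} = V - {X, Y} determines Z and W up to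
   exchanging them, and midpoint Z W is symmetric. *)
definition body_M0 :: "'a::euclidean_space set \<Rightarrow> 'a \<Rightarrow> 'a set" where
  "body_M0 V E = \<Union>{face_piece E X Y Z W | X Y Z W.
      X \<in> V \<and> Y \<in> V \<and> X \<noteq> Y \<and> {Z, W} = V - {X, Y}}"

definition body_M :: "'a::euclidean_space set \<Rightarrow> 'a \<Rightarrow> 'a set" where
  "body_M V E = (\<Inter>P\<in>body_M0 V E. cball P 1)"

definition body_M4 :: "'a::euclidean_space set \<Rightarrow> 'a set" where
  "body_M4 V = {v - w | v w. v \<in> pos V \<and> w \<in> pos V \<and>
      (norm v)\<^sup>2 + (norm w + 1 / sqrt 2)\<^sup>2 \<le> 1}"

definition body_U3 :: "'a::euclidean_space set \<Rightarrow> 'a \<Rightarrow> 'a set" where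
  "body_U3 V E = orthogonal_projection (orthogonal_hyperplane E) ` body_M4 V"

lemma posE:
  assumes "z \<in> pos T"
  obtains F c where "finite F" "F \<subseteq> T" "\<forall>x\<in>F. 0 \<le> c x" "z = (\<Sum>x\<in>F. c x *\<^sub>R x)"
proof -
  have "\<exists>F c. z = (\<Sum>x\<in>F. c x *\<^sub>R x) \<and> finite F \<and> F \<subseteq> T \<and> (\<forall>x\<in>F. 0 \<le> c x)"
    using assms unfolding pos_def mem_Collect_eq .
  then show thesis by (elim exE conjE) (rule that)
qed

lemma pos_eq_convex_cone_hull: "pos T = convex_cone hull T"
proof
  show "pos T \<subseteq> convex_cone hull T"
  proof
    fix z assume "z \<in> pos T"
    then obtain F c where F: "finite F" "F \<subseteq> T" "\<forall>x\<in>F. 0 \<le> c x"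
      and z: "z = (\<Sum>x\<in>F. c x *\<^sub>R x)"
      by (rule posE)
    from F have "(\<Sum>x\<in>F. c x *\<^sub>R x) \<in> convex_cone hull T"
    proof (induction F rule: finite_induct)
      case empty
      show ?case by (simp add: convex_cone_hull_contains_0)
    next
      case (insert x F)
      then have "c x *\<^sub>R x \<in> convex_cone hull T"
        by (intro convex_cone_hull_mul[OF hull_inc]) auto
      moreover have "(\<Sum>x\<in>F. c x *\<^sub>R x) \<in> convex_cone hull T"
        using insert by auto
      ultimately show ?case using insert.hyps by (simp add: convex_cone_hull_add)
    qed
    with z show "z \<in> convex_cone hull T" by simp
  qed
  have mem: "z \<in> pos T"
    if "finite F" "F \<subseteq> T" "\<forall>x\<in>F. 0 \<le> c x" "z = (\<Sum>x\<in>F. c x *\<^sub>R x)" for z F c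
    unfolding pos_def mem_Collect_eq
    by (rule exI[of _ F], rule exI[of _ c], intro conjI) (rule that)+
  have add: "x + y \<in> pos T" if xy: "x \<in> pos T" "y \<in> pos T" for x y
  proof -
    obtain F c where F: "finite F" "F \<subseteq> T" "\<forall>x\<in>F. 0 \<le> c x" "x = (\<Sum>x\<in>F. c x *\<^sub>R x)"
      using xy(1) by (rule posE)
    obtain G d where G: "finite G" "G \<subseteq> T" "\<forall>x\<in>G. 0 \<le> d x" "y = (\<Sum>x\<in>G. d x *\<^sub>R x)"
      using xy(2) by (rule posE)
    let ?c = "\<lambda>z. if z \<in> F then c z else 0"
    let ?d = "\<lambda>z. if z \<in> G then d z else 0"
    have "x = (\<Sum>z\<in>F \<union> G. ?c z *\<^sub>R z)"
      unfolding F(4) by (rule sum.mono_neutral_cong_left) (use F(1) G(1) in auto)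
    moreover have "y = (\<Sum>z\<in>F \<union> G. ?d z *\<^sub>R z)"
      unfolding G(4) by (rule sum.mono_neutral_cong_left) (use F(1) G(1) in auto)
    ultimately have "x + y = (\<Sum>z\<in>F \<union> G. (?c z + ?d z) *\<^sub>R z)"
      by (simp only: scaleR_add_left sum.distrib)
    then show ?thesis
      by (intro mem[of "F \<union> G" "\<lambda>z. ?c z + ?d z"]) (use F(1-3) G(1-3) in auto)
  qed
  have mul: "a *\<^sub>R x \<in> pos T" if xa: "x \<in> pos T" "0 \<le> a" for x a
  proof -
    obtain F c where F: "finite F" "F \<subseteq> T" "\<forall>x\<in>F. 0 \<le> c x" "x = (\<Sum>x\<in>F. c x *\<^sub>R x)"
      using xa(1) by (rule posE)
    have "a *\<^sub>R x = (\<Sum>z\<in>F. (a * c z) *\<^sub>R z)"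
      unfolding F(4) by (simp add: scaleR_sum_right)
    then show ?thesis
      by (intro mem[of F "\<lambda>z. a * c z"]) (use F(1-3) xa(2) in auto)
  qed
  have "0 \<in> pos T"
    by (rule mem[of "{}"]) auto
  then have "convex_cone (pos T)"
    unfolding convex_cone_def convex_def conic_def by (auto intro!: add mul)
  moreover have "T \<subseteq> pos T"
  proof
    fix x assume "x \<in> T"
    then show "x \<in> pos T"
      by (intro mem[of "{x}" "\<lambda>_. 1"]) auto
  qed
  ultimately show "convex_cone hull T \<subseteq> pos T"
    by (intro hull_minimal)
qed

lemma orthogonal_projection_eqI:
  assumes "subspace H" "p \<in> H" "\<And>y. y \<in> H \<Longrightarrow> orthogonal (x - p) y"
  shows "orthogonal_projection H x = p"
  unfolding orthogonal_projection_def
proof (rule the_equality)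
  show "p \<in> H \<and> (\<forall>y\<in>H. orthogonal (x - p) y)" using assms by blast
next
  fix q assume q: "q \<in> H \<and> (\<forall>y\<in>H. orthogonal (x - q) y)"
  then have "q - p \<in> H" using assms by (simp add: subspace_diff)
  then have "orthogonal (x - p) (q - p)" "orthogonal (x - q) (q - p)"
    using assms(3)[of "q - p"] q by auto
  then have "(q - p) \<bullet> (q - p) = 0"
    by (simp add: orthogonal_def inner_diff_left)
  then show "q = p" by simp
qed

lemma orthogonal_projection_hyperplane:
  assumes "E \<noteq> 0"
  shows "orthogonal_projection (orthogonal_hyperplane E) x = x - (x \<bullet> E / (E \<bullet> E)) *\<^sub>R E"
proof (rule orthogonal_projection_eqI)
  show "subspace (orthogonal_hyperplane E)"
    unfolding orthogonal_hyperplane_def by (rule subspace_orthogonal_to_vector)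
  have "E \<bullet> x = x \<bullet> E" by (rule inner_commute)
  with assms show "x - (x \<bullet> E / (E \<bullet> E)) *\<^sub>R E \<in> orthogonal_hyperplane E"
    by (simp add: orthogonal_hyperplane_def orthogonal_def inner_diff_right)
qed (simp add: orthogonal_hyperplane_def orthogonal_def)

text \<open>The coordinates of the vertices force \<open>A, B, C, D, E\<close> to be a regular simplex of side length 1.\<close>

lemma simplex_dist:
  assumes "norm X = 1 / sqrt 2" "norm Y = 1 / sqrt 2" "orthogonal X Y"
  shows "dist X Y = 1"
proof -
  have "X \<bullet> X = 1 / 2" "Y \<bullet> Y = 1 / 2"
    using assms(1,2) by (simp_all add: dot_square_norm power_divide)
  then have "(dist X Y)\<^sup>2 = 1"
    using assms(3)
    by (simp add: dist_norm power2_norm_eq_inner inner_diff orthogonal_def inner_commute)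
  then show ?thesis using power2_eq_imp_eq[of "dist X _" 1] by simp
qed

lemma simplex_dist_apex:
  assumes n: "norm A = 1 / sqrt 2" "norm B = 1 / sqrt 2" "norm C = 1 / sqrt 2" "norm D = 1 / sqrt 2"
    and o: "orthogonal A B" "orthogonal A C" "orthogonal A D" "orthogonal B C" "orthogonal B D"
      "orthogonal C D"
    and X: "X \<in> {A, B, C, D}"
  shows "dist X ((golden_ratio / 2) *\<^sub>R (A + B + C + D)) = 1"
proof -
  let ?S = "A + B + C + D"
  have sq: "A \<bullet> A = 1 / 2" "B \<bullet> B = 1 / 2" "C \<bullet> C = 1 / 2" "D \<bullet> D = 1 / 2"
    using n by (simp_all add: dot_square_norm power_divide)
  have orth: "A \<bullet> B = 0" "A \<bullet> C = 0" "A \<bullet> D = 0" "B \<bullet> C = 0" "B \<bullet> D = 0" "C \<bullet> D = 0"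
    using o by (simp_all add: orthogonal_def)
  have XS: "X \<bullet> ?S = 1 / 2" "X \<bullet> X = 1 / 2"
    using X by (auto simp: inner_add sq orth orth[THEN trans[OF inner_commute]])
  have SS: "?S \<bullet> ?S = 2"
    by (simp add: inner_add sq orth orth[THEN trans[OF inner_commute]])
  have g: "golden_ratio * golden_ratio = golden_ratio + 1"
    by (simp add: golden_ratio_def field_simps)
  have "(dist X ((golden_ratio / 2) *\<^sub>R ?S))\<^sup>2
      = X \<bullet> X - golden_ratio * (X \<bullet> ?S) + (golden_ratio * golden_ratio) / 4 * (?S \<bullet> ?S)"
    unfolding dist_norm power2_norm_eq_inner
    by (simp only: inner_diff inner_scaleR_left inner_scaleR_right inner_commute[of ?S X])
       (simp add: field_simps)
  also have "\<dots> = 1" unfolding XS SS g by (simp add: field_simps)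
  finally show ?thesis using power2_eq_imp_eq[of "dist X _" 1] by simp
qed

end

theory Submission
  imports Defs
begin

text \<open>In coordinates \<open>c\<close> with respect to the vertices, \<open>M\<^sub>4\<close> is the sublevel set
  \<open>|c|\<^sup>2 + 2 |c\<^sup>-| \<le> 1\<close>, where \<open>c\<^sup>-\<close> is the negative part, and \<open>\<pi>\<close> forgets a common
  shift of the coordinates. A face point with coordinates \<open>(a + q, b + q, q, q)\<close> contributes to
  \<open>\<M>\<close> the condition \<open>|c|\<^sup>2 - 1 \<le> 2 (a c\<^sub>X + b c\<^sub>Y + q (s - 1))\<close> with \<open>s\<close> the coordinate sum
  and \<open>a\<^sup>2 + b\<^sup>2 \<le> 1\<close>. Hence points of \<open>M\<^sub>4\<close> with \<open>s \<ge> 1\<close> lie in \<open>\<M>\<close>, and every point of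
  \<open>M\<^sub>4\<close> with \<open>s < 1\<close> can be shifted within \<open>M\<^sub>4\<close> to \<open>s = 1\<close>. Conversely, only the conditions
  with \<open>q = 0\<close> are needed: shift a point of \<open>\<M>\<close> up to \<open>s = 1\<close> if \<open>s < 1\<close>. Then at most two
  coordinates are negative, and if there are any, the condition for \<open>(a, b)\<close> proportional to
  \<open>c\<^sup>-\<close> puts the point in \<open>M\<^sub>4\<close>; a nonnegative point gets there by shifting it down until
  its least coordinate vanishes.\<close>

section \<open>Coordinate estimates for shifting \<open>body_M4\<close> into
  \<open>body_M\<close>\<close>

definition neg_norm :: "'a set \<Rightarrow> ('a \<Rightarrow> real) \<Rightarrow> real" where
  "neg_norm V c = L2_set (\<lambda>X. max 0 (- c X)) V"

definition penalized_norm :: "'a set \<Rightarrow> ('a \<Rightarrow> real) \<Rightarrow> real" where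
  "penalized_norm V c = (\<Sum>X\<in>V. (c X)\<^sup>2) + 2 * neg_norm V c"

lemma neg_norm_nonneg: "0 \<le> neg_norm V c"
  by (simp add: neg_norm_def)

lemma neg_norm_power2: "(neg_norm V c)\<^sup>2 = (\<Sum>X\<in>V. (max 0 (- c X))\<^sup>2)"
  by (simp add: neg_norm_def L2_set_def sum_nonneg)

lemma neg_norm_eq_0: "\<forall>X\<in>V. 0 \<le> c X \<Longrightarrow> neg_norm V c = 0"
  by (auto simp: neg_norm_def L2_set_def intro!: sum.neutral)

text \<open>Difference of squares in each coordinate. The increment is written with the coordinate
  sums before and after the shift, since these are what the later estimates bound.\<close>

lemma sum_power2_shift:
  fixes c :: "'a \<Rightarrow> real"
  shows "(\<Sum>X\<in>V. (c X + \<delta>)\<^sup>2) = (\<Sum>X\<in>V. (c X)\<^sup>2) + \<delta> * ((\<Sum>X\<in>V. c X) + (\<Sum>X\<in>V. c X + \<delta>))"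
proof -
  have "(\<Sum>X\<in>V. (c X + \<delta>)\<^sup>2) = (\<Sum>X\<in>V. (c X)\<^sup>2 + \<delta> * (c X + (c X + \<delta>)))"
    by (simp add: power2_eq_square algebra_simps)
  then show ?thesis by (simp only: sum.distrib flip: sum_distrib_left)
qed

lemma sum_power2_le_power2_sum:
  fixes c :: "'a \<Rightarrow> real"
  assumes "\<forall>X\<in>V. 0 \<le> c X"
  shows "(\<Sum>X\<in>V. (c X)\<^sup>2) \<le> (\<Sum>X\<in>V. c X)\<^sup>2"
proof -
  have "L2_set c V \<le> (\<Sum>X\<in>V. c X)"
    using assms by (intro L2_set_le_sum) auto
  then have "(L2_set c V)\<^sup>2 \<le> (\<Sum>X\<in>V. c X)\<^sup>2"
    by (intro power_mono) auto
  then show ?thesis by (simp add: L2_set_def sum_nonneg)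
qed

text \<open>Nonnegative coordinates carry no penalty, and their Euclidean norm is at most their
  sum.\<close>

lemma penalized_norm_le_1_of_sum:
  assumes "\<forall>X\<in>V. 0 \<le> c X" "(\<Sum>X\<in>V. c X) \<le> 1"
  shows "penalized_norm V c \<le> 1"
proof -
  have "(\<Sum>X\<in>V. c X)\<^sup>2 \<le> 1\<^sup>2"
    using assms by (intro power_mono sum_nonneg) auto
  then show ?thesis
    using sum_power2_le_power2_sum[OF assms(1)] neg_norm_eq_0[OF assms(1)]
    by (simp add: penalized_norm_def)
qed

text \<open>The quadratic equation says that the point with coordinates \<open>(a + q, b + q, q, q)\<close> lies on
  the sphere around \<open>midpoint Z W\<close>; see \<open>face_point_in_sphere_iff\<close>.\<close>

lemma face_coordinates_power2_le_1:
  fixes a b q :: real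
  assumes "0 \<le> a" "0 \<le> b" "0 \<le> q" "a\<^sup>2 + b\<^sup>2 + 2 * q * (a + b) + 4 * q\<^sup>2 - 2 * q = 1"
  shows "a\<^sup>2 + b\<^sup>2 \<le> 1"
proof -
  \<comment> \<open>The equation reads
    \<open>a\<^sup>2 + b\<^sup>2 + 2 * q * (a + b + 2 * q - 1) = 1\<close>, so it suffices that
    \<open>a + b + 2 * q\<close> is at least 1. This is seen from its square.\<close>
  have "(a + b + 2 * q)\<^sup>2 = 1 + 2 * q + 2 * (a * b) + 2 * (q * (a + b))"
    using assms(4) by (simp add: power2_eq_square algebra_simps)
  moreover have "0 \<le> a * b" "0 \<le> q * (a + b)" using assms by auto
  ultimately have "1\<^sup>2 \<le> (a + b + 2 * q)\<^sup>2" using assms(3) by simp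
  then have "1 \<le> a + b + 2 * q" by (rule power2_le_imp_le) (use assms in auto)
  then have "0 \<le> 2 * q * (a + b + 2 * q - 1)" using assms by auto
  then show ?thesis using assms(4) by (simp add: power2_eq_square algebra_simps)
qed

text \<open>Cauchy-Schwarz for \<open>(a, b)\<close> and the negative parts at \<open>X\<close> and
  \<open>Y\<close>. Replacing each coordinate by minus its negative part only decreases
  \<open>a * c X + b * c Y\<close>.\<close>

lemma neg_norm_two_coordinates:
  assumes "finite V" "X \<in> V" "Y \<in> V" "X \<noteq> Y" "0 \<le> a" "0 \<le> b" "a\<^sup>2 + b\<^sup>2 \<le> 1"
  shows "- neg_norm V c \<le> a * c X + b * c Y"
proof -
  let ?x = "max 0 (- c X)" and ?y = "max 0 (- c Y)"
  have "(\<Sum>Z\<in>{X, Y}. (max 0 (- c Z))\<^sup>2) \<le> (\<Sum>Z\<in>V. (max 0 (- c Z))\<^sup>2)"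
    using assms by (intro sum_mono2) auto
  then have xy: "?x\<^sup>2 + ?y\<^sup>2 \<le> (neg_norm V c)\<^sup>2"
    using assms(4) by (simp add: neg_norm_power2)
  have "(a * ?x + b * ?y)\<^sup>2 \<le> (a\<^sup>2 + b\<^sup>2) * (?x\<^sup>2 + ?y\<^sup>2)"
    using zero_le_power2[of "a * ?y - b * ?x"] by (simp add: power2_eq_square algebra_simps)
  also have "\<dots> \<le> 1 * (neg_norm V c)\<^sup>2"
    using assms(7) xy by (intro mult_mono) auto
  finally have "a * ?x + b * ?y \<le> neg_norm V c"
    using neg_norm_nonneg by (auto intro: power2_le_imp_le)
  moreover have "a * (- c X) \<le> a * ?x" "b * (- c Y) \<le> b * ?y"
    using assms by (intro mult_left_mono; simp)+
  ultimately show ?thesis by simp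
qed

text \<open>The term with \<open>q\<close> is nonnegative because the coordinate sum is at least 1.
  Since \<open>(a, b)\<close> lies in the unit disc, the penalty absorbs the other two
  terms.\<close>

lemma penalized_norm_face_bound:
  assumes "finite V" "X \<in> V" "Y \<in> V" "X \<noteq> Y" "0 \<le> a" "0 \<le> b" "0 \<le> q"
    and "a\<^sup>2 + b\<^sup>2 + 2 * q * (a + b) + 4 * q\<^sup>2 - 2 * q = 1"
    and "penalized_norm V c \<le> 1" "1 \<le> (\<Sum>Z\<in>V. c Z)"
  shows "(\<Sum>Z\<in>V. (c Z)\<^sup>2) - 1 \<le> 2 * (a * c X + b * c Y + q * ((\<Sum>Z\<in>V. c Z) - 1))"
proof -
  have "- neg_norm V c \<le> a * c X + b * c Y"
    using assms face_coordinates_power2_le_1[of a b q] by (intro neg_norm_two_coordinates) auto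
  moreover have "0 \<le> q * ((\<Sum>Z\<in>V. c Z) - 1)" using assms by auto
  ultimately show ?thesis using assms(9) by (simp add: penalized_norm_def)
qed

text \<open>Along the diagonal the derivative of \<open>penalized_norm\<close> is at most \<open>2 * (\<Sum>X\<in>V. c X) - 2\<close>
  as long as some coordinate is negative; the proof below is the integrated form.\<close>

lemma penalized_norm_shift_up:
  assumes V: "finite V" and \<delta>: "0 \<le> \<delta>" and c: "penalized_norm V c \<le> 1"
    and s: "(\<Sum>X\<in>V. c X + \<delta>) \<le> 1"
  shows "penalized_norm V (\<lambda>X. c X + \<delta>) \<le> 1"
proof (cases "\<forall>X\<in>V. 0 \<le> c X + \<delta>")
  case True
  then show ?thesis using s by (rule penalized_norm_le_1_of_sum)
next
  case False
  define y where "y X = c X + \<delta>" for X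
  let ?u = "\<lambda>X. max 0 (- y X)" and ?w = "\<lambda>X. max 0 (- c X)"
  have r: "(neg_norm V y)\<^sup>2 = (\<Sum>X\<in>V. (?u X)\<^sup>2)" by (rule neg_norm_power2)
  obtain X where X: "X \<in> V" "y X < 0" using False by (auto simp: y_def)
  have "0 < (?u X)\<^sup>2" using X by auto
  also have "\<dots> \<le> (\<Sum>X\<in>V. (?u X)\<^sup>2)" using V X by (intro member_le_sum) auto
  finally have "0 < neg_norm V y" using r neg_norm_nonneg[of V y]
    by (metis less_le power_zero_numeral)
  \<comment> \<open>The aim is that \<open>neg_norm\<close> drops by at least \<delta>. After
    multiplication by \<open>neg_norm V y\<close> this is Cauchy-Schwarz: where \<open>?u\<close> is
    positive, \<open>?w = ?u + \<delta>\<close>, and the Euclidean norm of \<open>?u\<close> is at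
    most its sum.\<close>
  moreover have "(neg_norm V y) * (neg_norm V y + \<delta>) \<le> neg_norm V y * neg_norm V c"
  proof -
    have "neg_norm V y \<le> (\<Sum>X\<in>V. ?u X)"
      unfolding neg_norm_def by (rule L2_set_le_sum) simp
    then have "neg_norm V y * (neg_norm V y + \<delta>) \<le> (\<Sum>X\<in>V. (?u X)\<^sup>2) + \<delta> * (\<Sum>X\<in>V. ?u X)"
      using \<delta> r by (simp add: power2_eq_square algebra_simps mult_left_mono)
    also have "\<dots> = (\<Sum>X\<in>V. ?u X * (?u X + \<delta>))"
      by (simp add: sum_distrib_left sum.distrib power2_eq_square algebra_simps)
    also have "\<dots> \<le> (\<Sum>X\<in>V. \<bar>?u X\<bar> * \<bar>?w X\<bar>)"
      by (intro sum_mono) (auto simp: y_def max_def intro: mult_left_mono)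
    also have "\<dots> \<le> neg_norm V y * neg_norm V c"
      unfolding neg_norm_def by (rule L2_set_mult_ineq)
    finally show ?thesis .
  qed
  ultimately have le: "neg_norm V y + \<delta> \<le> neg_norm V c" by simp
  \<comment> \<open>Both coordinate sums are at most 1, so the squares grow by at most
    \<open>2 * \<delta>\<close>, which the drop of the doubled penalty compensates.\<close>
  have "(\<Sum>X\<in>V. c X) \<le> (\<Sum>X\<in>V. c X + \<delta>)" using \<delta> by (intro sum_mono) auto
  then have "\<delta> * ((\<Sum>X\<in>V. c X) + (\<Sum>X\<in>V. c X + \<delta>)) \<le> \<delta> * 2"
    using s \<delta> by (intro mult_left_mono) auto
  then have "penalized_norm V y \<le> penalized_norm V c"
    using le sum_power2_shift[of c \<delta> V] by (simp add: penalized_norm_def y_def)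
  then show ?thesis using c by (simp add: y_def[abs_def])
qed

section \<open>Coordinate estimates for shifting \<open>body_M\<close> into
  \<open>body_M4\<close>\<close>

text \<open>Apply \<open>H\<close> to the unit vector \<open>(a, b)\<close> along the negative parts
  of the shifted coordinates; \<open>Y\<close> gets weight 0 if it is not negative. For nonzero
  \<delta> the shift adds at most \<open>2 * \<delta>\<close> to the squares, while the linear term
  supplies \<open>2 * \<delta> * (a + b)\<close>, and \<open>a + b \<ge> 1\<close> on the quarter
  circle.\<close>

lemma penalized_norm_of_few_negative:
  assumes V: "finite V" "X \<in> V" "Y \<in> V" "X \<noteq> Y"
    and H: "\<And>a b. 0 \<le> a \<Longrightarrow> 0 \<le> b \<Longrightarrow> a\<^sup>2 + b\<^sup>2 = 1 \<Longrightarrow>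
      (\<Sum>Z\<in>V. (c Z)\<^sup>2) - 1 \<le> 2 * (a * c X + b * c Y)"
    and \<delta>: "0 \<le> \<delta>" "\<delta> = 0 \<or> (\<Sum>Z\<in>V. c Z + \<delta>) \<le> 1"
    and neg: "c X + \<delta> < 0" "\<And>Z. Z \<in> V \<Longrightarrow> Z \<noteq> X \<Longrightarrow> Z \<noteq> Y \<Longrightarrow> 0 \<le> c Z + \<delta>"
  shows "penalized_norm V (\<lambda>Z. c Z + \<delta>) \<le> 1"
proof -
  define y where "y Z = c Z + \<delta>" for Z
  define r where "r = neg_norm V y"
  let ?u = "max 0 (- y X)" and ?v = "max 0 (- y Y)"
  have "(\<Sum>Z\<in>V. (max 0 (- y Z))\<^sup>2) = (\<Sum>Z\<in>{X, Y}. (max 0 (- y Z))\<^sup>2)"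
    using V neg(2) by (intro sum.mono_neutral_right) (force simp: y_def)+
  then have r2: "r\<^sup>2 = ?u\<^sup>2 + ?v\<^sup>2" using V by (simp add: r_def neg_norm_power2)
  have "0 < ?u\<^sup>2" using neg(1) by (auto simp: y_def)
  then have "0 < r\<^sup>2" unfolding r2 by (simp add: add_pos_nonneg)
  then have r: "0 < r" using neg_norm_nonneg[of V y] by (auto simp: r_def less_le)
  define a where "a = ?u / r"
  define b where "b = ?v / r"
  have ab: "0 \<le> a" "0 \<le> b" "a\<^sup>2 + b\<^sup>2 = 1"
    using r r2 by (auto simp: a_def b_def power_divide simp flip: add_divide_distrib)
  have "1\<^sup>2 \<le> (a + b)\<^sup>2" using ab mult_nonneg_nonneg[OF ab(1,2)]
    by (simp add: power2_sum)
  then have ab1: "1 \<le> a + b" by (rule power2_le_imp_le) (use ab in auto)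
  have "?u * y X = - ?u\<^sup>2" "?v * y Y = - ?v\<^sup>2"
    by (auto simp: max_def power2_eq_square)
  then have "a * y X + b * y Y = - ((?u\<^sup>2 + ?v\<^sup>2) / r)"
    by (simp add: a_def b_def add_divide_distrib)
  also have "\<dots> = - r" using r unfolding r2[symmetric] by (simp add: power2_eq_square)
  finally have yr: "a * c X + b * c Y = - r - \<delta> * (a + b)" by (simp add: y_def algebra_simps)
  have "\<delta> * ((\<Sum>Z\<in>V. c Z) + (\<Sum>Z\<in>V. c Z + \<delta>)) \<le> 2 * (\<delta> * (a + b))"
  proof (cases "\<delta> = 0")
    case False
    have "(\<Sum>Z\<in>V. c Z) \<le> (\<Sum>Z\<in>V. c Z + \<delta>)" using \<delta> by (intro sum_mono) auto
    then have "(\<Sum>Z\<in>V. c Z) + (\<Sum>Z\<in>V. c Z + \<delta>) \<le> 2 * (a + b)"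
      using False \<delta> ab1 by auto
    then have "\<delta> * ((\<Sum>Z\<in>V. c Z) + (\<Sum>Z\<in>V. c Z + \<delta>)) \<le> \<delta> * (2 * (a + b))"
      using \<delta>(1) by (rule mult_left_mono)
    then show ?thesis by (simp only: mult.left_commute)
  qed simp
  then have "penalized_norm V y \<le> 1"
    using H[OF ab] yr sum_power2_shift[of c \<delta> V]
    unfolding penalized_norm_def r_def[symmetric] by (simp add: y_def)
  then show ?thesis by (simp add: y_def[abs_def])
qed

text \<open>A sum below 1 is raised to exactly 1 by spreading the deficit evenly; otherwise nothing
  is shifted. Both inclusions start from this \<delta>.\<close>

lemma ex_shift_sum_ge_1:
  fixes c :: "'a \<Rightarrow> real"
  assumes "finite V" "V \<noteq> {}"
  obtains \<delta> where "0 \<le> \<delta>" "1 \<le> (\<Sum>X\<in>V. c X + \<delta>)" "\<delta> = 0 \<or> (\<Sum>X\<in>V. c X + \<delta>) \<le> 1"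
proof (cases "1 \<le> (\<Sum>X\<in>V. c X)")
  case True
  then show thesis by (intro that[of 0]) auto
next
  case False
  have "(\<Sum>X\<in>V. c X + (1 - sum c V) / card V) = 1"
    using assms by (simp add: sum.distrib)
  then show thesis using False by (intro that[of "(1 - sum c V) / card V"]) auto
qed

text \<open>\<open>H\<close> collects the conditions of \<open>body_M\<close> for face points with
  \<open>q = 0\<close>. Each of them controls two coordinates, so the proof splits by the number of
  negative coordinates after the shift; three or more contradict \<open>H\<close>.\<close>

lemma penalized_norm_shift_of_arc_bounds:
  assumes card: "card V = 4"
    and H: "\<And>X Y a b. X \<in> V \<Longrightarrow> Y \<in> V \<Longrightarrow> X \<noteq> Y \<Longrightarrow> 0 \<le> a \<Longrightarrow> 0 \<le> b \<Longrightarrow> a\<^sup>2 + b\<^sup>2 = 1 \<Longrightarrow>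
      (\<Sum>Z\<in>V. (c Z)\<^sup>2) - 1 \<le> 2 * (a * c X + b * c Y)"
  shows "\<exists>\<delta>. penalized_norm V (\<lambda>X. c X + \<delta>) \<le> 1"
proof -
  have V: "finite V" using card by (simp add: card_ge_0_finite)
  have other: "\<exists>Y\<in>V. X \<noteq> Y" for X
  proof (rule ccontr)
    assume "\<not> ?thesis"
    then have "V \<subseteq> {X}" by auto
    then have "card V \<le> card {X}" by (intro card_mono) auto
    with card show False by simp
  qed
  \<comment> \<open>The endpoint \<open>(1, 0)\<close> of the arc is the ball condition for the
    vertex \<open>X\<close> itself.\<close>
  have H1: "(\<Sum>Z\<in>V. (c Z)\<^sup>2) - 1 \<le> 2 * c X" if X: "X \<in> V" for X
    using other[of X] H[of X _ 1 0] X by auto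
  have ne: "V \<noteq> {}" using card by auto
  obtain \<delta> where \<delta>: "0 \<le> \<delta>" "1 \<le> (\<Sum>X\<in>V. c X + \<delta>)" "\<delta> = 0 \<or> (\<Sum>X\<in>V. c X + \<delta>) \<le> 1"
    by (rule ex_shift_sum_ge_1[OF V ne])
  define N where "N = {X\<in>V. c X + \<delta> < 0}"
  have finN: "finite N" using V by (simp add: N_def)
  consider "N = {}" "(\<Sum>X\<in>V. c X + \<delta>) \<le> 1" | "N = {}" "1 < (\<Sum>X\<in>V. c X + \<delta>)"
    | "N \<noteq> {}" "card N \<le> 2" | "3 \<le> card N" by linarith
  then show ?thesis
  proof cases
    case 1
    then show ?thesis by (intro exI penalized_norm_le_1_of_sum) (auto simp: N_def not_less)
  next
    case 2
    with \<delta> have "\<delta> = 0" by auto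
    with 2 have nonneg: "\<forall>X\<in>V. 0 \<le> c X" and sum: "1 < (\<Sum>X\<in>V. c X)"
      by (auto simp: N_def not_less)
    \<comment> \<open>Shift down until the least coordinate vanishes. If the sum still exceeds 1,
      the squares drop by at least \<open>2 * m\<close>, which is exactly the slack that
      \<open>H1\<close> allows at the minimizing vertex.\<close>
    define m where "m = Min (c ` V)"
    have "m \<in> c ` V" using V ne unfolding m_def by (intro Min_in) auto
    then obtain X where X: "X \<in> V" "m = c X" by auto
    have le: "\<forall>Y\<in>V. 0 \<le> c Y + - m" using V by (simp add: m_def)
    have m0: "0 \<le> m" using X nonneg by simp
    show ?thesis
    proof (cases "(\<Sum>Y\<in>V. c Y + - m) \<le> 1")
      case True
      with le show ?thesis by (intro exI penalized_norm_le_1_of_sum)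
    next
      case False
      then have "m * 2 \<le> m * ((\<Sum>Y\<in>V. c Y) + (\<Sum>Y\<in>V. c Y + - m))"
        using sum m0 by (intro mult_left_mono) auto
      then have "penalized_norm V (\<lambda>Y. c Y + - m) \<le> 1"
        using H1[OF X(1)] X(2) neg_norm_eq_0[OF le] sum_power2_shift[of c "- m" V]
        by (simp add: penalized_norm_def)
      then show ?thesis by blast
    qed
  next
    case 3
    then obtain X where X: "X \<in> N" by auto
    have XV: "X \<in> V" "c X + \<delta> < 0" using X by (auto simp: N_def)
    \<comment> \<open>A lone negative coordinate is paired with an arbitrary second one.\<close>
    have "\<exists>Y\<in>V. X \<noteq> Y \<and> N \<subseteq> {X, Y}"
    proof (cases "N = {X}")
      case True
      then show ?thesis using other[of X] by auto
    next
      case False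
      then obtain Y where Y: "Y \<in> N" "Y \<noteq> X" using X by auto
      then have "card {X, Y} = 2" by auto
      then have "{X, Y} = N" using 3 X Y finN by (intro card_seteq) auto
      then show ?thesis using Y by (auto simp: N_def)
    qed
    then obtain Y where Y: "Y \<in> V" "X \<noteq> Y" "N \<subseteq> {X, Y}" by auto
    have "penalized_norm V (\<lambda>Z. c Z + \<delta>) \<le> 1"
      by (rule penalized_norm_of_few_negative[of V X Y])
        (use V XV Y H \<delta> in \<open>auto simp: N_def not_less\<close>)
    then show ?thesis by blast
  next
    case 4
    \<comment> \<open>The sum is at least 1, so some coordinate is positive. The other three are
      then negative, so this one is at least 1 after the shift.\<close>
    obtain W where W: "W \<in> V" "0 < c W + \<delta>"
    proof (rule ccontr)
      assume "\<not> thesis"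
      then have "(\<Sum>X\<in>V. c X + \<delta>) \<le> 0" using that by (intro sum_nonpos) force
      with \<delta> show False by simp
    qed
    have sub: "N \<subseteq> V - {W}" using W by (auto simp: N_def)
    have N: "N = V - {W}"
      using sub 4 V W card by (intro card_seteq) auto
    obtain Z where Z: "Z \<in> N" using 4 by fastforce
    have "(\<Sum>X\<in>V. c X + \<delta>) = (c W + \<delta>) + (\<Sum>X\<in>N. c X + \<delta>)"
      unfolding N using V W(1) by (rule sum.remove)
    moreover have "(\<Sum>X\<in>N. c X + \<delta>) \<le> 0" by (intro sum_nonpos) (auto simp: N_def)
    ultimately have cW: "1 \<le> c W + \<delta>" using \<delta> by linarith
    \<comment> \<open>Impossible: \<open>1 + c Z \<le> c W\<close> is incompatible with the bound at the vertex \<open>Z\<close>.\<close>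
    have cZ: "c Z + \<delta> < 0" "Z \<in> V" "Z \<noteq> W" using Z W by (auto simp: N_def)
    have "(\<Sum>X\<in>{W, Z}. (c X)\<^sup>2) \<le> (\<Sum>X\<in>V. (c X)\<^sup>2)"
      using V W cZ by (intro sum_mono2) auto
    then have le: "(c W)\<^sup>2 + (c Z)\<^sup>2 \<le> 1 + 2 * c Z"
      using H1[of Z] cZ by simp
    then have "0 \<le> 1 + c Z"
      using zero_le_power2[of "c W"] zero_le_power2[of "c Z"] cZ \<delta> by linarith
    moreover have "1 + c Z \<le> c W" using cW cZ by linarith
    ultimately have "(1 + c Z)\<^sup>2 \<le> (c W)\<^sup>2" by (intro power_mono)
    then have "2 * (c Z)\<^sup>2 \<le> 0" using le by (simp add: power2_eq_square algebra_simps)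
    moreover have "0 < (c Z)\<^sup>2" using cZ \<delta> by auto
    ultimately show ?thesis by simp
  qed
qed

section \<open>Positive cones and the projection along \<open>E\<close>\<close>

text \<open>Peeling off one generator at a time allows coinciding generators, so
  \<open>pos_triple\<close> can be stated without distinctness.\<close>

lemma pos_insertE:
  assumes "z \<in> pos (insert x T)"
  obtains a w where "0 \<le> a" "w \<in> pos T" "z = a *\<^sub>R x + w"
proof -
  obtain F c where F: "finite F" "F \<subseteq> insert x T" "\<forall>y\<in>F. 0 \<le> c y" "z = (\<Sum>y\<in>F. c y *\<^sub>R y)"
    using assms by (rule posE)
  have "(\<Sum>y\<in>F - {x}. c y *\<^sub>R y) \<in> pos T"
    unfolding pos_def mem_Collect_eq
    by (intro exI[of _ "F - {x}"] exI[of _ c]) (use F in auto)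
  moreover have "z = (if x \<in> F then c x else 0) *\<^sub>R x + (\<Sum>y\<in>F - {x}. c y *\<^sub>R y)"
    using F by (auto simp: sum.remove)
  moreover have "0 \<le> (if x \<in> F then c x else 0)" using F by auto
  ultimately show thesis using that by blast
qed

lemma pos_empty: "pos {} = {0}"
  by (auto simp: pos_def)

lemma pos_triple:
  "z \<in> pos {X, Y, E} \<longleftrightarrow> (\<exists>a b e. 0 \<le> a \<and> 0 \<le> b \<and> 0 \<le> e \<and> z = a *\<^sub>R X + b *\<^sub>R Y + e *\<^sub>R E)"
proof
  assume "z \<in> pos {X, Y, E}"
  then show "\<exists>a b e. 0 \<le> a \<and> 0 \<le> b \<and> 0 \<le> e \<and> z = a *\<^sub>R X + b *\<^sub>R Y + e *\<^sub>R E"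
    by (elim pos_insertE) (force simp: pos_empty add.assoc)
next
  assume "\<exists>a b e. 0 \<le> a \<and> 0 \<le> b \<and> 0 \<le> e \<and> z = a *\<^sub>R X + b *\<^sub>R Y + e *\<^sub>R E"
  then show "z \<in> pos {X, Y, E}"
    unfolding pos_eq_convex_cone_hull
    by (elim exE conjE, hypsubst) (intro convex_cone_hull_add convex_cone_hull_mul hull_inc; simp)
qed

lemma pos_finite:
  assumes "finite T"
  shows "z \<in> pos T \<longleftrightarrow> (\<exists>c. (\<forall>x\<in>T. 0 \<le> c x) \<and> z = (\<Sum>x\<in>T. c x *\<^sub>R x))"
proof
  assume "z \<in> pos T"
  then obtain F c where F: "finite F" "F \<subseteq> T" "\<forall>x\<in>F. 0 \<le> c x" "z = (\<Sum>x\<in>F. c x *\<^sub>R x)"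
    by (rule posE)
  have "z = (\<Sum>x\<in>T. (if x \<in> F then c x else 0) *\<^sub>R x)"
    unfolding F(4) by (rule sum.mono_neutral_cong_left) (use F assms in auto)
  with F(3) show "\<exists>c. (\<forall>x\<in>T. 0 \<le> c x) \<and> z = (\<Sum>x\<in>T. c x *\<^sub>R x)"
    by (intro exI[of _ "\<lambda>x. if x \<in> F then c x else 0"]) auto
next
  assume "\<exists>c. (\<forall>x\<in>T. 0 \<le> c x) \<and> z = (\<Sum>x\<in>T. c x *\<^sub>R x)"
  with assms show "z \<in> pos T" unfolding pos_def by blast
qed

lemma orthogonal_projection_hyperplane_add:
  assumes "E \<noteq> 0"
  shows "orthogonal_projection (orthogonal_hyperplane E) (x + t *\<^sub>R E)
    = orthogonal_projection (orthogonal_hyperplane E) x"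
  using assms
  by (simp add: orthogonal_projection_hyperplane inner_add_left add_divide_distrib scaleR_add_left)

section \<open>Coordinates with respect to the vertices\<close>

locale scaled_orthonormal_basis =
  fixes V :: "'a::euclidean_space set"
  assumes card_V: "card V = DIM('a)"
    and orthogonal_V: "pairwise orthogonal V"
    and norm_V: "X \<in> V \<Longrightarrow> norm X = 1 / sqrt 2"
begin

definition comb :: "('a \<Rightarrow> real) \<Rightarrow> 'a" where
  "comb c = (\<Sum>X\<in>V. c X *\<^sub>R X)"

lemma finite_V: "finite V"
  using card_V DIM_positive[where 'a = 'a] by (metis card_ge_0_finite)

lemma inner_V: "X \<in> V \<Longrightarrow> Y \<in> V \<Longrightarrow> X \<bullet> Y = (if X = Y then 1 / 2 else 0)"
  using orthogonal_V norm_V[of X]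
  by (auto simp: pairwise_def orthogonal_def dot_square_norm power_divide)

lemma inner_comb_left: "X \<in> V \<Longrightarrow> X \<bullet> comb c = c X / 2"
  using finite_V by (simp add: comb_def inner_sum_right inner_V if_distrib cong: if_cong)

lemma inner_comb: "comb c \<bullet> comb d = (\<Sum>X\<in>V. c X * d X) / 2"
  by (simp add: comb_def[of c] inner_sum_left inner_comb_left sum_divide_distrib)

lemma norm_comb: "norm (comb c) = L2_set c V / sqrt 2"
  by (simp add: norm_eq_sqrt_inner inner_comb L2_set_def real_sqrt_divide power2_eq_square)

lemma ex_comb: "\<exists>c. x = comb c"
proof -
  have "0 \<notin> V" using norm_V by fastforce
  then have "independent V" by (rule pairwise_orthogonal_independent[OF orthogonal_V])
  then have "UNIV \<subseteq> span V"
    by (rule card_ge_dim_independent[rotated]) (simp_all add: card_V)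
  then show ?thesis using span_finite[OF finite_V] by (auto simp: comb_def)
qed

lemma comb_eq_iff: "comb c = comb d \<longleftrightarrow> (\<forall>X\<in>V. c X = d X)"
proof
  assume "comb c = comb d"
  then have "X \<bullet> comb c = X \<bullet> comb d" for X by simp
  then show "\<forall>X\<in>V. c X = d X" by (metis inner_comb_left div_by_1 divide_cancel_right zero_neq_numeral)
qed (simp add: comb_def)

lemma comb_diff: "comb c - comb d = comb (\<lambda>X. c X - d X)"
  by (simp add: comb_def sum_subtractf scaleR_diff_left)

lemma comb_shift: "comb (\<lambda>X. c X + \<delta>) = comb c + \<delta> *\<^sub>R \<Sum>V"
  by (simp add: comb_def scaleR_add_left sum.distrib scaleR_sum_right)

text \<open>Expanding the square leaves \<open>1 / 2\<close> on the left. Subtracting it and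
  doubling cancels the factors \<open>1 / sqrt 2\<close> that come from
  \<open>norm_comb\<close>.\<close>

lemma body_M4_condition:
  "(norm (comb a))\<^sup>2 + (norm (comb b) + 1 / sqrt 2)\<^sup>2 \<le> 1
    \<longleftrightarrow> (\<Sum>X\<in>V. (a X)\<^sup>2) + (\<Sum>X\<in>V. (b X)\<^sup>2) + 2 * L2_set b V \<le> 1"
proof -
  have "(L2_set c V)\<^sup>2 = (\<Sum>X\<in>V. (c X)\<^sup>2)" for c
    by (simp add: L2_set_def sum_nonneg)
  then show ?thesis
    by (simp add: norm_comb power_divide power2_sum field_simps)
qed

text \<open>Common parts of \<open>v\<close> and \<open>w\<close> only increase both norms, so the optimal
  decomposition \<open>v - w\<close> is into positive and negative part.\<close>

lemma comb_in_body_M4_iff: "comb c \<in> body_M4 V \<longleftrightarrow> penalized_norm V c \<le> 1"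
proof
  assume "comb c \<in> body_M4 V"
  then obtain v w where vw: "comb c = v - w" "v \<in> pos V" "w \<in> pos V"
    "(norm v)\<^sup>2 + (norm w + 1 / sqrt 2)\<^sup>2 \<le> 1" by (auto simp: body_M4_def)
  obtain a where a: "\<forall>X\<in>V. 0 \<le> a X" "v = comb a"
    using vw(2) by (auto simp: pos_finite finite_V comb_def)
  obtain b where b: "\<forall>X\<in>V. 0 \<le> b X" "w = comb b"
    using vw(3) by (auto simp: pos_finite finite_V comb_def)
  have c: "\<forall>X\<in>V. c X = a X - b X"
    using vw(1) unfolding a(2) b(2) comb_diff comb_eq_iff .
  have "(\<Sum>X\<in>V. (c X)\<^sup>2) \<le> (\<Sum>X\<in>V. (a X)\<^sup>2 + (b X)\<^sup>2)"
    using a b c by (intro sum_mono) (auto simp: power2_diff)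
  moreover have "neg_norm V c \<le> L2_set b V"
    unfolding neg_norm_def using a b c by (intro L2_set_mono) auto
  ultimately show "penalized_norm V c \<le> 1"
    using vw(4) unfolding a(2) b(2) body_M4_condition
    by (simp add: penalized_norm_def sum.distrib)
next
  assume c: "penalized_norm V c \<le> 1"
  let ?a = "\<lambda>X. max 0 (c X)" and ?b = "\<lambda>X. max 0 (- c X)"
  have "(\<Sum>X\<in>V. (?a X)\<^sup>2) + (\<Sum>X\<in>V. (?b X)\<^sup>2) = (\<Sum>X\<in>V. (c X)\<^sup>2)"
    unfolding sum.distrib[symmetric] by (intro sum.cong) (auto simp: max_def)
  then have "(norm (comb ?a))\<^sup>2 + (norm (comb ?b) + 1 / sqrt 2)\<^sup>2 \<le> 1"
    using c unfolding body_M4_condition by (simp add: penalized_norm_def neg_norm_def)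
  moreover have "comb c = comb ?a - comb ?b"
    unfolding comb_diff comb_eq_iff by (auto simp: max_def)
  moreover have "comb ?a \<in> pos V" "comb ?b \<in> pos V"
    unfolding pos_finite[OF finite_V] comb_def
    by (rule exI[of _ ?a], simp) (rule exI[of _ ?b], simp)
  ultimately show "comb c \<in> body_M4 V" unfolding body_M4_def by blast
qed

section \<open>Face points and their ball conditions\<close>

lemma inner_sum_V:
  assumes "X \<in> V"
  shows "X \<bullet> \<Sum>V = 1 / 2"
  using inner_comb_left[OF assms, of "\<lambda>_. 1"] by (simp add: comb_def)

lemma comb_inner_sum_V: "comb c \<bullet> \<Sum>V = (\<Sum>X\<in>V. c X) / 2"
  using inner_comb[of c "\<lambda>_. 1"] by (simp add: comb_def)

lemma sum_V_inner_sum_V: "\<Sum>V \<bullet> \<Sum>V = card V / 2"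
  using comb_inner_sum_V[of "\<lambda>_. 1"] by (simp add: comb_def)

text \<open>The centre is half of \<open>\<Sum>V - X - Y\<close>, so only inner products among
  \<open>X\<close>, \<open>Y\<close> and \<open>\<Sum>V\<close> remain. The squared distance is half
  the quadratic expression plus \<open>1 / 4\<close>, to be compared with
  \<open>3 / 4\<close>.\<close>

lemma face_point_in_sphere_iff:
  assumes V: "card V = 4" "X \<in> V" "Y \<in> V" "X \<noteq> Y" "{Z, W} = V - {X, Y}"
  shows "a *\<^sub>R X + b *\<^sub>R Y + q *\<^sub>R \<Sum>V \<in> sphere (midpoint Z W) (sqrt 3 / 2)
    \<longleftrightarrow> a\<^sup>2 + b\<^sup>2 + 2 * q * (a + b) + 4 * q\<^sup>2 - 2 * q = 1"
proof -
  have "card {Z, W} = 2" unfolding V(5) using V finite_V by (simp add: card_Diff_subset)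
  then have ZW: "Z \<noteq> W" by auto
  have "\<Sum>V = \<Sum>{X, Y} + \<Sum>(V - {X, Y})"
    using V finite_V by (simp add: sum.subset_diff[of "{X, Y}" V] add.commute)
  also have "\<dots> = X + Y + (Z + W)" using V(4) ZW by (simp flip: V(5))
  finally have S: "Z + W = \<Sum>V - X - Y" by (simp add: algebra_simps)
  let ?d = "midpoint Z W - (a *\<^sub>R X + b *\<^sub>R Y + q *\<^sub>R \<Sum>V)"
  have d: "?d = (1 / 2 - q) *\<^sub>R \<Sum>V - (a + 1 / 2) *\<^sub>R X - (b + 1 / 2) *\<^sub>R Y"
    unfolding midpoint_def S by (simp add: algebra_simps)
  have ip: "X \<bullet> X = 1 / 2" "Y \<bullet> Y = 1 / 2" "X \<bullet> Y = 0" "Y \<bullet> X = 0"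
    "X \<bullet> \<Sum>V = 1 / 2" "Y \<bullet> \<Sum>V = 1 / 2" "\<Sum>V \<bullet> X = 1 / 2" "\<Sum>V \<bullet> Y = 1 / 2" "\<Sum>V \<bullet> \<Sum>V = 2"
    using V by (simp_all add: inner_V inner_sum_V sum_V_inner_sum_V
        inner_commute[of "\<Sum>V" X] inner_commute[of "\<Sum>V" Y])
  have "?d \<bullet> ?d = (a\<^sup>2 + b\<^sup>2 + 2 * q * (a + b) + 4 * q\<^sup>2 - 2 * q) / 2 + 1 / 4"
    unfolding d by (simp add: inner_diff inner_add ip power2_eq_square field_simps)
  moreover have "dist (midpoint Z W) (a *\<^sub>R X + b *\<^sub>R Y + q *\<^sub>R \<Sum>V) = sqrt 3 / 2 \<longleftrightarrow> ?d \<bullet> ?d = 3 / 4"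
  proof -
    have "norm ?d = sqrt 3 / 2 \<longleftrightarrow> (norm ?d)\<^sup>2 = (sqrt 3 / 2)\<^sup>2"
      by (rule power2_eq_iff_nonneg[symmetric]) auto
    then show ?thesis by (simp add: dist_norm power2_norm_eq_inner power_divide)
  qed
  ultimately show ?thesis by auto
qed

text \<open>The sphere equation \<open>K\<close> reduces the squared norm of the face point to
  \<open>1 / 2 + q\<close>, which makes the ball condition linear in \<open>a\<close>,
  \<open>b\<close> and \<open>q\<close>.\<close>

lemma comb_in_cball_face_point_iff:
  assumes V: "card V = 4" "X \<in> V" "Y \<in> V" "X \<noteq> Y"
    and K: "a\<^sup>2 + b\<^sup>2 + 2 * q * (a + b) + 4 * q\<^sup>2 - 2 * q = 1"
  shows "comb c \<in> cball (a *\<^sub>R X + b *\<^sub>R Y + q *\<^sub>R \<Sum>V) 1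
    \<longleftrightarrow> (\<Sum>Z\<in>V. (c Z)\<^sup>2) - 1 \<le> 2 * (a * c X + b * c Y + q * ((\<Sum>Z\<in>V. c Z) - 1))"
proof -
  let ?P = "a *\<^sub>R X + b *\<^sub>R Y + q *\<^sub>R \<Sum>V"
  have ip: "X \<bullet> X = 1 / 2" "Y \<bullet> Y = 1 / 2" "X \<bullet> Y = 0" "Y \<bullet> X = 0"
    "X \<bullet> \<Sum>V = 1 / 2" "Y \<bullet> \<Sum>V = 1 / 2" "\<Sum>V \<bullet> X = 1 / 2" "\<Sum>V \<bullet> Y = 1 / 2" "\<Sum>V \<bullet> \<Sum>V = 2"
    using V by (simp_all add: inner_V inner_sum_V sum_V_inner_sum_V
        inner_commute[of "\<Sum>V" X] inner_commute[of "\<Sum>V" Y])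
  have PP: "?P \<bullet> ?P = 1 / 2 + q"
    using K by (simp add: inner_add ip power2_eq_square field_simps)
  have cP: "comb c \<bullet> ?P = (a * c X + b * c Y + q * (\<Sum>Z\<in>V. c Z)) / 2"
    using V by (simp add: inner_add_right comb_inner_sum_V inner_comb_left
        inner_commute[of "comb c" X] inner_commute[of "comb c" Y] field_simps)
  have cc: "comb c \<bullet> comb c = (\<Sum>Z\<in>V. (c Z)\<^sup>2) / 2"
    by (simp add: inner_comb power2_eq_square)
  have "comb c \<in> cball ?P 1 \<longleftrightarrow> (norm (comb c - ?P))\<^sup>2 \<le> 1"
    by (simp add: dist_norm norm_minus_commute abs_square_le_1)
  also have "(norm (comb c - ?P))\<^sup>2 = comb c \<bullet> comb c - 2 * (comb c \<bullet> ?P) + ?P \<bullet> ?P"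
    unfolding power2_norm_eq_inner by (simp only: inner_diff inner_commute[of ?P "comb c"])
  finally have "comb c \<in> cball ?P 1 \<longleftrightarrow> comb c \<bullet> comb c - 2 * (comb c \<bullet> ?P) + ?P \<bullet> ?P \<le> 1" .
  also have "\<dots> \<longleftrightarrow> (\<Sum>Z\<in>V. (c Z)\<^sup>2) - 1 \<le> 2 * (a * c X + b * c Y + q * ((\<Sum>Z\<in>V. c Z) - 1))"
  proof -
    have "s / 2 - 2 * (t / 2) + (1 / 2 + q) \<le> 1 \<longleftrightarrow> s - 1 \<le> 2 * (t - q)" for s t :: real
      by auto
    moreover have "a * c X + b * c Y + q * ((\<Sum>Z\<in>V. c Z) - 1)
        = a * c X + b * c Y + q * (\<Sum>Z\<in>V. c Z) - q"
      by (simp add: algebra_simps)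
    ultimately show ?thesis unfolding PP cP cc by (simp only:)
  qed
  finally show ?thesis .
qed

text \<open>The coefficient \<open>e\<close> of \<open>E\<close> becomes \<open>q = e * k\<close>;
  since \<open>k\<close> is positive, the sign condition carries over in both directions.\<close>

lemma body_M0_iff:
  assumes V: "card V = 4" and E: "E = k *\<^sub>R \<Sum>V" and k: "0 < k"
  shows "P \<in> body_M0 V E \<longleftrightarrow> (\<exists>X Y a b (q::real). X \<in> V \<and> Y \<in> V \<and> X \<noteq> Y \<and> 0 \<le> a \<and> 0 \<le> b \<and> 0 \<le> q
    \<and> a\<^sup>2 + b\<^sup>2 + 2 * q * (a + b) + 4 * q\<^sup>2 - 2 * q = 1 \<and> P = a *\<^sub>R X + b *\<^sub>R Y + q *\<^sub>R \<Sum>V)"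
    (is "_ \<longleftrightarrow> ?R")
proof
  assume "P \<in> body_M0 V E"
  then obtain X Y Z W where XY: "X \<in> V" "Y \<in> V" "X \<noteq> Y" "{Z, W} = V - {X, Y}"
    and P: "P \<in> pos {X, Y, E}" "P \<in> sphere (midpoint Z W) (sqrt 3 / 2)"
    by (auto simp: body_M0_def face_piece_def)
  obtain a b e where ab: "0 \<le> a" "0 \<le> b" "0 \<le> e" "P = a *\<^sub>R X + b *\<^sub>R Y + (e * k) *\<^sub>R \<Sum>V"
    using P(1) unfolding pos_triple E by auto
  have "a\<^sup>2 + b\<^sup>2 + 2 * (e * k) * (a + b) + 4 * (e * k)\<^sup>2 - 2 * (e * k) = 1"
    using P(2) unfolding ab(4) face_point_in_sphere_iff[OF V XY] .
  moreover have "0 \<le> e * k" using ab k by simp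
  ultimately show ?R using ab XY by blast
next
  assume ?R
  then obtain X Y a b q where XY: "X \<in> V" "Y \<in> V" "X \<noteq> Y"
    and ab: "0 \<le> a" "0 \<le> b" "0 \<le> q" "a\<^sup>2 + b\<^sup>2 + 2 * q * (a + b) + 4 * q\<^sup>2 - 2 * q = 1"
    and P: "P = a *\<^sub>R X + b *\<^sub>R Y + q *\<^sub>R \<Sum>V" by blast
  have "card (V - {X, Y}) = 2" using V XY finite_V by (simp add: card_Diff_subset)
  then obtain Z W where ZW: "{Z, W} = V - {X, Y}" by (metis card_2_iff)
  have "P = a *\<^sub>R X + b *\<^sub>R Y + (q / k) *\<^sub>R E" "0 \<le> q / k" using P E k ab by auto
  then have "P \<in> pos {X, Y, E}" unfolding pos_triple using ab by blast
  moreover have "P \<in> sphere (midpoint Z W) (sqrt 3 / 2)"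
    unfolding P face_point_in_sphere_iff[OF V XY ZW] by (rule ab(4))
  ultimately show "P \<in> body_M0 V E"
    unfolding body_M0_def face_piece_def using XY ZW by blast
qed

lemma comb_in_body_M_iff:
  assumes "card V = 4" "E = k *\<^sub>R \<Sum>V" "0 < k"
  shows "comb c \<in> body_M V E \<longleftrightarrow> (\<forall>X\<in>V. \<forall>Y\<in>V. \<forall>a\<ge>0. \<forall>b\<ge>0. \<forall>q\<ge>0. X \<noteq> Y \<longrightarrow>
    a\<^sup>2 + b\<^sup>2 + 2 * q * (a + b) + 4 * q\<^sup>2 - 2 * q = 1 \<longrightarrow>
    (\<Sum>Z\<in>V. (c Z)\<^sup>2) - 1 \<le> 2 * (a * c X + b * c Y + q * ((\<Sum>Z\<in>V. c Z) - 1)))"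
    (is "_ \<longleftrightarrow> ?R")
proof
  assume L: "comb c \<in> body_M V E"
  show ?R
  proof (intro ballI allI impI)
    fix X Y a b and q :: real
    assume A: "X \<in> V" "Y \<in> V" "0 \<le> a" "0 \<le> b" "0 \<le> q" "X \<noteq> Y"
      and K: "a\<^sup>2 + b\<^sup>2 + 2 * q * (a + b) + 4 * q\<^sup>2 - 2 * q = 1"
    then have "a *\<^sub>R X + b *\<^sub>R Y + q *\<^sub>R \<Sum>V \<in> body_M0 V E"
      unfolding body_M0_iff[OF assms] by blast
    then have "comb c \<in> cball (a *\<^sub>R X + b *\<^sub>R Y + q *\<^sub>R \<Sum>V) 1"
      using L unfolding body_M_def by blast
    then show "(\<Sum>Z\<in>V. (c Z)\<^sup>2) - 1 \<le> 2 * (a * c X + b * c Y + q * ((\<Sum>Z\<in>V. c Z) - 1))"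
      using comb_in_cball_face_point_iff[OF assms(1) A(1,2,6) K] by blast
  qed
next
  assume R: ?R
  show "comb c \<in> body_M V E"
    unfolding body_M_def
  proof
    fix P assume "P \<in> body_M0 V E"
    then obtain X Y a b q where XY: "X \<in> V" "Y \<in> V" "X \<noteq> Y" "0 \<le> a" "0 \<le> b" "0 \<le> q"
      and K: "a\<^sup>2 + b\<^sup>2 + 2 * q * (a + b) + 4 * q\<^sup>2 - 2 * q = 1"
      and P: "P = a *\<^sub>R X + b *\<^sub>R Y + q *\<^sub>R \<Sum>V"
      unfolding body_M0_iff[OF assms] by blast
    show "comb c \<in> cball P 1"
      unfolding P comb_in_cball_face_point_iff[OF assms(1) XY(1-3) K]
      using R XY K by blast
  qed
qed

section \<open>Equality of the two projections\<close>

theorem projection_body_M4_eq_body_M: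
  assumes card: "card V = 4" and E: "E = k *\<^sub>R \<Sum>V" and k: "0 < k"
  shows "orthogonal_projection (orthogonal_hyperplane E) ` body_M4 V
    = orthogonal_projection (orthogonal_hyperplane E) ` body_M V E"
proof -
  let ?\<pi> = "orthogonal_projection (orthogonal_hyperplane E)"
  have "\<Sum>V \<noteq> 0" using sum_V_inner_sum_V card by auto
  then have "E \<noteq> 0" using E k by simp
  \<comment> \<open>Shifting all coordinates by \<delta> adds
    \<open>\<delta> *\<^sub>R \<Sum>V\<close>, which is \<open>\<delta> / k\<close> times
    \<open>E\<close>.\<close>
  then have "?\<pi> (comb c + (\<delta> / k) *\<^sub>R E) = ?\<pi> (comb c)" for c \<delta>
    by (rule orthogonal_projection_hyperplane_add)
  then have proj: "?\<pi> (comb (\<lambda>X. c X + \<delta>)) = ?\<pi> (comb c)" for c \<delta>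
    using k by (simp add: comb_shift E)
  show ?thesis
  proof (intro equalityI image_subsetI)
    fix x assume x: "x \<in> body_M4 V"
    obtain c where xc: "x = comb c" using ex_comb by blast
    have c: "penalized_norm V c \<le> 1" using x by (simp add: xc comb_in_body_M4_iff)
    have "V \<noteq> {}" using card by auto
    then obtain \<delta> where \<delta>: "0 \<le> \<delta>" "1 \<le> (\<Sum>X\<in>V. c X + \<delta>)"
      "\<delta> = 0 \<or> (\<Sum>X\<in>V. c X + \<delta>) \<le> 1"
      by (rule ex_shift_sum_ge_1[OF finite_V])
    have "penalized_norm V (\<lambda>X. c X + \<delta>) \<le> 1"
    proof (cases "\<delta> = 0")
      case False
      then show ?thesis using finite_V c \<delta> by (intro penalized_norm_shift_up) auto
    qed (use c in simp)
    with \<delta>(2) have "comb (\<lambda>X. c X + \<delta>) \<in> body_M V E"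
      unfolding comb_in_body_M_iff[OF assms]
      by (intro ballI allI impI penalized_norm_face_bound finite_V)
    then show "?\<pi> x \<in> ?\<pi> ` body_M V E" unfolding xc proj[of c \<delta>, symmetric] by (rule imageI)
  next
    fix x assume x: "x \<in> body_M V E"
    obtain c where xc: "x = comb c" using ex_comb by blast
    have "(\<Sum>Z\<in>V. (c Z)\<^sup>2) - 1 \<le> 2 * (a * c X + b * c Y)"
      if "X \<in> V" "Y \<in> V" "X \<noteq> Y" "0 \<le> a" "0 \<le> b" "a\<^sup>2 + b\<^sup>2 = 1" for X Y a b
    proof -
      \<comment> \<open>The sphere equation at \<open>q = 0\<close>, with the zeros kept so that it
        matches the instance of the condition for \<open>body_M\<close>.\<close>
      have "a\<^sup>2 + b\<^sup>2 + 2 * 0 * (a + b) + 4 * 0\<^sup>2 - 2 * 0 = 1" using that by simp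
      then have "(\<Sum>Z\<in>V. (c Z)\<^sup>2) - 1 \<le> 2 * (a * c X + b * c Y + 0 * ((\<Sum>Z\<in>V. c Z) - 1))"
        using x that order_refl[of 0] unfolding xc comb_in_body_M_iff[OF assms] by blast
      then show ?thesis by simp
    qed
    then obtain \<delta> where "penalized_norm V (\<lambda>X. c X + \<delta>) \<le> 1"
      using penalized_norm_shift_of_arc_bounds[OF card, of c] by blast
    then have "comb (\<lambda>X. c X + \<delta>) \<in> body_M4 V" by (simp add: comb_in_body_M4_iff)
    then show "?\<pi> x \<in> ?\<pi> ` body_M4 V" unfolding xc proj[of c \<delta>, symmetric] by (rule imageI)
  qed
qed

end

theorem proposition5p2:
  fixes A B C D E :: "real ^ 4"
  assumes "distinct [A, B, C, D]"
    and "pairwise orthogonal {A, B, C, D}"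
    and "\<forall>X\<in>{A, B, C, D}. norm X = 1 / sqrt 2"
    and "E = (golden_ratio / 2) *\<^sub>R (A + B + C + D)"
  shows "body_U3 {A, B, C, D} E
       = orthogonal_projection (orthogonal_hyperplane E) ` body_M {A, B, C, D} E"
proof -
  have card: "card {A, B, C, D} = 4" using assms(1) by simp
  interpret scaled_orthonormal_basis "{A, B, C, D}"
    using assms(2,3) card by unfold_locales auto
  have "E = (golden_ratio / 2) *\<^sub>R \<Sum>{A, B, C, D}"
    using assms(1,4) by (simp add: add.assoc)
  moreover have "0 < golden_ratio / 2"
    by (simp add: golden_ratio_def add_pos_pos)
  ultimately show ?thesis
    unfolding body_U3_def by (rule projection_body_M4_eq_body_M[OF card])
qed

end
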